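(* Let $G$ be a finite reflection group acting on $\mathbb{R}^n$ with closed fundamental chamber $\mathcal{C}$, and let $f:\mathbb{R}^n\to\mathbb{R}$ be a convex function invariant under $G$. Then for all $x,y\in\mathbb{R}^n$, $y\in\partial f(x)$ if and only if $$\check y\in\partial f(\check x)\quad\text{and}\quad \langle \check x,\check y\rangle=\langle x,y\rangle,$$ where $\check x$ (resp. $\check y$) denotes the unique point in the intersection of the $G$-orbit of $x$ (resp. of $y$) with $\mathcal{C}$.
   Context: A finite reflection group $G$ on $\mathbb{R}^n$ is a finite subgroup of the orthogonal group $O(n)$ generated by reflections $h_u$, $h_u x=(I-2uu^{T})x$, $u$ a unit vector. Its root system is $\Phi=\{u:\|u\|=1,\ h_u\in G\}$. A positive root system is a set $U\subset\Phi$ for which there is a linear functional $\ell:\mathbb{R}^n\to\mathbb{R}$ with $\ell(u)>0$ for all $u\in U$ and $\ell(u)<0$ for all $u\in\Phi\setminus U$. Fix a positive root system $U$; the closed fundamental chamber is $\mathcal{C}=\{x\in\mathbb{R}^n:\langle x,u\rangle\ge 0\ \forall u\in U\}$. The orbit of $x$ is $\mathcal{O}(x)=\{gx: g\in G\}$. It is a known fact that $\mathcal{O}(x)\cap\mathcal{C}$ is a singleton for every $x\in\mathbb{R}^n$; its unique element is denoted $\check x$. Here $\langle x,y\rangle=x^{T}y$. A function $f$ is invariant under $G$ if $f(gx)=f(x)$ for all $g\in G$, $x\in\mathbb{R}^n$. For convex $f:\mathbb{R}^n\to\mathbb{R}$, the (Moreau-Rockafellar) subdifferential is $\partial f(x)=\{v\in\mathbb{R}^n: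 f(z)\ge f(x)+\langle v,z-x\rangle\ \forall z\in\mathbb{R}^n\}$. *)

theory Defs
  imports "HOL-Analysis.Analysis" "HOL-Algebra.Generated_Groups"
begin

definition orthogonal_group :: "(real^'n^'n) monoid" where
  "orthogonal_group = \<lparr>carrier = {A. orthogonal_matrix A}, mult = (**), one = mat 1\<rparr>"

lemma group_orthogonal_group: "group (orthogonal_group :: (real^'n^'n) monoid)"
proof (rule groupI)
  fix A :: "real^'n^'n"
  assume "A \<in> carrier orthogonal_group"
  then have "orthogonal_matrix A"
    by (simp add: orthogonal_group_def)
  then have "orthogonal_matrix (transpose A)" "transpose A ** A = mat 1"
    by (auto simp: orthogonal_matrix_def)
  then show "\<exists>B\<in>carrier orthogonal_group.
      B \<otimes>\<^bsub>orthogonal_group\<^esub> A = \<one>\<^bsub>orthogonal_group\<^esub>"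
    by (intro bexI[of _ "transpose A"]) (simp_all add: orthogonal_group_def)
qed (auto simp: orthogonal_group_def orthogonal_matrix_mul orthogonal_matrix_id
    matrix_mul_assoc)

text \<open>The matrix \<open>I - 2 u u\<^sup>T\<close>; it is a reflection only for unit vectors \<open>u\<close>.\<close>

definition reflection_matrix :: "real^'n \<Rightarrow> real^'n^'n" where
  "reflection_matrix u = mat 1 - 2 *\<^sub>R (\<chi> i j. u $ i * u $ j)"

lemma reflection_matrix_vector_mult:
  "reflection_matrix u *v x = x - (2 * (u \<bullet> x)) *\<^sub>R u"
proof -
  have "(\<chi> i j. u $ i * u $ j) *v x = (u \<bullet> x) *\<^sub>R u"
    by (simp add: vec_eq_iff matrix_vector_mult_def inner_vec_def sum_distrib_left mult_ac)
  then show ?thesis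
    by (simp add: reflection_matrix_def matrix_vector_mult_diff_rdistrib
        flip: scaleR_matrix_vector_assoc)
qed

definition finite_reflection_group :: "(real^'n^'n) set \<Rightarrow> bool" where
  "finite_reflection_group G \<longleftrightarrow>
     finite G \<and> subgroup G orthogonal_group \<and>
     (\<exists>R. R \<subseteq> reflection_matrix ` {u. norm u = 1} \<and> G = generate orthogonal_group R)"

definition root_system :: "(real^'n^'n) set \<Rightarrow> (real^'n) set" where
  "root_system G = {u. norm u = 1 \<and> reflection_matrix u \<in> G}"

definition positive_root_system :: "(real^'n^'n) set \<Rightarrow> (real^'n) set \<Rightarrow> bool" where
  "positive_root_system G U \<longleftrightarrow>
     U \<subseteq> root_system G \<and>
     (\<exists>l :: real^'n \<Rightarrow> real. linear l \<and> (\<forall>u\<in>U. l u > 0) \<and> (\<forall>u\<in>root_system G - U. l u < 0))"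

definition fundamental_chamber :: "(real^'n) set \<Rightarrow> (real^'n) set" where
  "fundamental_chamber U = {x. \<forall>u\<in>U. x \<bullet> u \<ge> 0}"

definition matrix_orbit :: "(real^'n^'n) set \<Rightarrow> real^'n \<Rightarrow> (real^'n) set" where
  "matrix_orbit G x = {g *v x |g. g \<in> G}"

text \<open>Meaningful only when the intersection is a singleton, which is a classical theorem if
  \<open>G\<close> is a finite reflection group and \<open>U\<close> one of its positive root systems.\<close>

definition chamber_rep :: "(real^'n^'n) set \<Rightarrow> (real^'n) set \<Rightarrow> real^'n \<Rightarrow> real^'n" where
  "chamber_rep G U x = (THE z. z \<in> matrix_orbit G x \<inter> fundamental_chamber U)"

definition invariant_under :: "(real^'n^'n) set \<Rightarrow> (real^'n \<Rightarrow> real) \<Rightarrow> bool" where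
  "invariant_under G f \<longleftrightarrow> (\<forall>g\<in>G. \<forall>x. f (g *v x) = f x)"

definition subdifferential :: "(real^'n \<Rightarrow> real) \<Rightarrow> real^'n \<Rightarrow> (real^'n) set" where
  "subdifferential f x = {v. \<forall>z. f z \<ge> f x + v \<bullet> (z - x)}"

end

theory Submission
  imports Defs
begin

text \<open>The functional \<open>y \<bullet> z - f z\<close> of \<open>z\<close> has the same supremum for \<open>y\<close> as for any point of
  its orbit, and \<open>y\<close> is a subgradient at \<open>x\<close> iff \<open>x\<close> attains this supremum. So everything reduces
  to the equality of \<open>x \<bullet> y\<close> with the inner product of the two representatives. A subgradient
  \<open>y\<close> at \<open>x\<close> maximises \<open>x \<bullet> g y\<close> over \<open>g\<close> in \<open>G\<close>, and for chamber points \<open>a\<close>, \<open>b\<close> the maximum of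
  \<open>a \<bullet> g b\<close> is \<open>a \<bullet> b\<close>. The last fact, which also makes the representatives unique, is shown by
  induction on the length of \<open>g\<close> as a word in simple reflections. A positive root is called simple
  here if its reflection maps all other positive roots to positive roots; this avoids any discussion
  of generators of cones.\<close>

section \<open>Reflections\<close>

declare transpose_matrix_vector [simp del]

lemma inner_transpose_matrix_vector:
  fixes g :: "real^'n^'m"
  shows "(transpose g *v x) \<bullet> y = x \<bullet> (g *v y)"
  by (simp add: transpose_matrix_vector dot_lmul_matrix)

lemma reflection_matrix_uminus [simp]: "reflection_matrix (- u) = reflection_matrix u"
  by (simp add: reflection_matrix_def)

lemma transpose_reflection_matrix [simp]:
  "transpose (reflection_matrix u) = reflection_matrix u"
  by (simp add: reflection_matrix_def transpose_def vec_eq_iff mat_def mult.commute)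

lemma reflection_matrix_square:
  assumes "norm u = 1"
  shows "reflection_matrix u ** reflection_matrix u = mat 1"
proof -
  have "(reflection_matrix u ** reflection_matrix u) *v x = mat 1 *v x" for x
    using assms
    by (simp add: reflection_matrix_vector_mult inner_diff_right dot_square_norm
        flip: matrix_vector_mul_assoc)
  then show ?thesis by (simp add: matrix_eq)
qed

lemma reflection_matrix_orthogonal_image:
  fixes g :: "real^'n^'n"
  assumes "orthogonal_matrix g"
  shows "reflection_matrix (g *v u) = g ** reflection_matrix u ** transpose g"
proof -
  have [simp]: "g *v (transpose g *v x) = x" for x
    using assms by (simp add: matrix_vector_mul_assoc orthogonal_matrix_def)
  have "reflection_matrix (g *v u) *v x = (g ** reflection_matrix u ** transpose g) *v x" for x
    by (simp add: reflection_matrix_vector_mult matrix_vector_mult_diff_distrib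
        matrix_vector_mult_scaleR inner_transpose_matrix_vector inner_commute[of u]
        inner_commute[of "g *v u"] flip: matrix_vector_mul_assoc)
  then show ?thesis
    by (simp add: matrix_eq)
qed

lemma orthogonal_matrix_inner:
  fixes g :: "real^'n^'n"
  assumes "orthogonal_matrix g"
  shows "(g *v x) \<bullet> (g *v y) = x \<bullet> y"
  using assms inner_transpose_matrix_vector[of g "g *v x" y]
  by (simp add: matrix_vector_mul_assoc orthogonal_matrix_def)

lemma orthogonal_group_inv:
  fixes g :: "real^'n^'n"
  assumes "orthogonal_matrix g"
  shows "inv\<^bsub>orthogonal_group\<^esub> g = transpose g"
  by (rule group.inv_equality[OF group_orthogonal_group])
     (use assms in \<open>auto simp: orthogonal_group_def orthogonal_matrix_def\<close>)

section \<open>Positive and simple roots\<close>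

text \<open>The functional \<open>l\<close> is fixed because it later serves as a height: it selects
  simple roots, orders an induction on positive roots and finds chamber points.\<close>

locale positive_roots =
  fixes G :: "(real^'n^'n) set" and U :: "(real^'n) set" and l :: "real^'n \<Rightarrow> real"
  assumes group: "finite_reflection_group G"
    and roots: "U \<subseteq> root_system G"
    and linear_l: "linear l"
    and l_pos: "u \<in> U \<Longrightarrow> l u > 0"
    and l_neg: "u \<in> root_system G - U \<Longrightarrow> l u < 0"
begin

lemma subgroup_G: "subgroup G orthogonal_group"
  and finite_G: "finite G"
  using group by (auto simp: finite_reflection_group_def)

lemma orthogonal: "g \<in> G \<Longrightarrow> orthogonal_matrix g"
  using subgroup.subset[OF subgroup_G] by (auto simp: orthogonal_group_def)

lemma mult_mem: "g \<in> G \<Longrightarrow> h \<in> G \<Longrightarrow> g ** h \<in> G"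
  using subgroup.m_closed[OF subgroup_G] by (auto simp: orthogonal_group_def)

lemma one_mem: "mat 1 \<in> G"
  using subgroup.one_closed[OF subgroup_G] by (auto simp: orthogonal_group_def)

lemma transpose_mem: "g \<in> G \<Longrightarrow> transpose g \<in> G"
  using subgroup.m_inv_closed[OF subgroup_G] orthogonal_group_inv[OF orthogonal] by force

lemma inverse_vec [simp]:
  assumes "g \<in> G"
  shows "transpose g *v (g *v x) = x" "g *v (transpose g *v x) = x"
  using orthogonal[OF assms] by (simp_all add: matrix_vector_mul_assoc orthogonal_matrix_def)

lemma inner_image: "g \<in> G \<Longrightarrow> (g *v x) \<bullet> (g *v y) = x \<bullet> y"
  by (rule orthogonal_matrix_inner[OF orthogonal])

lemma norm_image: "g \<in> G \<Longrightarrow> norm (g *v x) = norm x"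
  by (simp add: norm_eq_sqrt_inner inner_image)

lemma norm_root: "u \<in> U \<Longrightarrow> norm u = 1"
  and reflection_mem: "u \<in> U \<Longrightarrow> reflection_matrix u \<in> G"
  using roots by (auto simp: root_system_def)

lemma root_image:
  assumes "g \<in> G" "u \<in> root_system G"
  shows "g *v u \<in> root_system G"
  using assms
  by (auto simp: root_system_def norm_image reflection_matrix_orthogonal_image orthogonal
      intro!: mult_mem transpose_mem)

lemma uminus_root: "u \<in> root_system G \<Longrightarrow> - u \<in> root_system G"
  by (simp add: root_system_def)

lemma l_uminus: "l (- u) = - l u"
  by (rule linear_neg[OF linear_l])

lemma positive_or_negative: "u \<in> root_system G \<Longrightarrow> u \<notin> U \<Longrightarrow> - u \<in> U"
  using l_neg[of u] l_neg[of "- u"] uminus_root[of u] l_uminus[of u] by force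

lemma l_reflection: "l (reflection_matrix u *v x) = l x - 2 * (u \<bullet> x) * l u"
  by (simp add: reflection_matrix_vector_mult linear_diff[OF linear_l] linear_scale[OF linear_l])

text \<open>Equality case of Cauchy-Schwarz for unit vectors.\<close>

lemma positive_root_eqI:
  assumes u: "u \<in> U" and v: "v \<in> U" and inner: "u \<bullet> v \<ge> 1"
  shows "u = v"
proof -
  have "(u - v) \<bullet> (u - v) = 2 - 2 * (u \<bullet> v)"
    using norm_root[OF u] norm_root[OF v]
    by (simp add: inner_diff_left inner_diff_right norm_eq_1 inner_commute)
  with inner have "(u - v) \<bullet> (u - v) \<le> 0" by simp
  then show ?thesis by (metis eq_iff_diff_eq_0 inner_gt_zero_iff not_less)
qed

text \<open>A reflection determines its root up to sign, and \<open>l\<close> fixes the sign, so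
  finiteness carries over from \<open>G\<close>.\<close>

lemma finite_U: "finite U"
proof (rule inj_on_finite[OF _ _ finite_G])
  show "reflection_matrix ` U \<subseteq> G"
    using reflection_mem by auto
  show "inj_on reflection_matrix U"
  proof (rule inj_onI)
    fix u v assume u: "u \<in> U" and v: "v \<in> U" and eq: "reflection_matrix u = reflection_matrix v"
    have "reflection_matrix u *v u = reflection_matrix v *v u"
      using eq by simp
    then have "2 *\<^sub>R u = 2 *\<^sub>R ((v \<bullet> u) *\<^sub>R v)"
      using norm_root[OF u] by (simp add: reflection_matrix_vector_mult dot_square_norm)
    then have uv: "u = (v \<bullet> u) *\<^sub>R v"
      by (simp only: scaleR_cancel_left) simp
    then have "\<bar>v \<bullet> u\<bar> = 1"
      using norm_root[OF u] norm_root[OF v] by (metis norm_scaleR mult.right_neutral)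
    moreover have "l u = (v \<bullet> u) * l v"
      using arg_cong[OF uv, of l] by (simp add: linear_scale[OF linear_l])
    then have "v \<bullet> u > 0"
      using l_pos[OF u] l_pos[OF v] by (simp add: zero_less_mult_iff)
    ultimately show "u = v"
      using positive_root_eqI[OF v u] by simp
  qed
qed

definition simple :: "(real^'n) set" where
  "simple = {a \<in> U. \<forall>v \<in> U - {a}. reflection_matrix a *v v \<in> U}"

lemma simple_imp_positive: "a \<in> simple \<Longrightarrow> a \<in> U"
  by (simp add: simple_def)

lemma simple_reflection: "a \<in> simple \<Longrightarrow> v \<in> U \<Longrightarrow> v \<noteq> a \<Longrightarrow> reflection_matrix a *v v \<in> U"
  by (simp add: simple_def)

text \<open>The point \<open>v / l v\<close> maximises first \<open>u \<bullet> _\<close> and then the norm over all normalised positive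
  roots. If \<open>v\<close> were not simple, this point would be a proper convex combination of two others.\<close>

lemma ex_simple_inner_pos:
  assumes u: "u \<in> U"
  shows "\<exists>a \<in> simple. u \<bullet> a > 0"
proof -
  define r where "r v = (u \<bullet> v) / l v" for v
  define M where "M = Max (r ` U)"
  have M: "r v \<le> M" if "v \<in> U" for v
    using that finite_U by (simp add: M_def)
  have "M \<in> r ` U"
    unfolding M_def using finite_U u by (intro Max_in) auto
  then have "finite {v \<in> U. r v = M}" "{v \<in> U. r v = M} \<noteq> {}"
    using finite_U by auto
  note fin = this
  obtain v where v: "v \<in> U" "r v = M" and min: "\<And>w. w \<in> U \<Longrightarrow> r w = M \<Longrightarrow> l v \<le> l w"
    using that[of "arg_min_on l {v \<in> U. r v = M}"] arg_min_if_finite(1)[OF fin, of l]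
      arg_min_least[OF fin, of _ l] by auto
  have inner_le: "u \<bullet> w \<le> M * l w" if "w \<in> U" for w
    using M[OF that] l_pos[OF that] by (simp add: r_def field_simps)
  have inner_v: "u \<bullet> v = M * l v"
    using v l_pos[OF v(1)] by (auto simp: r_def field_simps)
  have r_eq: "r w = M" if "w \<in> U" "u \<bullet> w = M * l w" for w
    using that l_pos[OF that(1)] by (simp add: r_def)
  have "0 < M"
    using inner_le[OF u] l_pos[OF u] norm_root[OF u]
    by (simp add: dot_square_norm) (smt (verit) mult_nonpos_nonneg)
  have "v \<in> simple"
  proof (rule ccontr)
    assume "v \<notin> simple"
    then obtain w where w: "w \<in> U" "w \<noteq> v" "reflection_matrix v *v w \<notin> U"
      using v by (auto simp: simple_def)
    \<comment> \<open>The reflected root is not positive, so its negative \<open>z\<close> is, and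
      \<open>w + z\<close> is a multiple of \<open>v\<close>.\<close>
    define z where "z = - (reflection_matrix v *v w)"
    have z: "z \<in> U"
      unfolding z_def using w v roots
      by (intro positive_or_negative root_image reflection_mem) auto
    have z_eq: "z = (2 * (v \<bullet> w)) *\<^sub>R v - w"
      by (simp add: z_def reflection_matrix_vector_mult)
    have lz: "l z = 2 * (v \<bullet> w) * l v - l w"
      by (simp add: z_eq linear_diff[OF linear_l] linear_scale[OF linear_l])
    have "u \<bullet> z = 2 * (v \<bullet> w) * (M * l v) - u \<bullet> w"
      by (simp add: z_eq inner_diff_right inner_v)
    also have "\<dots> = M * l z + M * l w - u \<bullet> w"
      by (simp add: lz algebra_simps)
    \<comment> \<open>The bounds \<open>inner_le\<close> for \<open>w\<close> and \<open>z\<close>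
      add up to an equality, so both are tight.\<close>
    finally have "u \<bullet> w = M * l w" "u \<bullet> z = M * l z"
      using inner_le[OF w(1)] inner_le[OF z] by linarith+
    then have "l v \<le> l w" "l v \<le> l z"
      using min r_eq w(1) z by auto
    then have "1 * l v \<le> (v \<bullet> w) * l v"
      using lz by simp
    then have "v \<bullet> w \<ge> 1"
      using l_pos[OF v(1)] by (simp only: mult_le_cancel_right)
    then show False
      using positive_root_eqI[OF v(1) w(1)] w(2) by simp
  qed
  then show ?thesis
    using inner_v \<open>0 < M\<close> l_pos[OF v(1)] by force
qed

section \<open>Words in simple reflections\<close>

inductive word :: "nat \<Rightarrow> real^'n^'n \<Rightarrow> bool" where
  word_0: "word 0 (mat 1)"
| word_Suc: "a \<in> simple \<Longrightarrow> word n w \<Longrightarrow> word (Suc n) (reflection_matrix a ** w)"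

lemma word_0_iff [simp]: "word 0 w \<longleftrightarrow> w = mat 1"
  by (subst word.simps) simp

lemma word_Suc_iff:
  "word (Suc n) g \<longleftrightarrow> (\<exists>a w. a \<in> simple \<and> word n w \<and> g = reflection_matrix a ** w)"
  by (subst word.simps) auto

lemma word_mem: "word n w \<Longrightarrow> w \<in> G"
  by (induction rule: word.induct)
     (auto intro: one_mem mult_mem reflection_mem simple_imp_positive)

lemma word_mult:
  assumes "word m v" "word n w"
  shows "word (m + n) (v ** w)"
  using assms(1) by induction (auto simp: assms(2) word_Suc simp flip: matrix_mul_assoc)

lemma word_simple: "a \<in> simple \<Longrightarrow> word 1 (reflection_matrix a)"
  using word_Suc[OF _ word_0] by simp

text \<open>Words grow on the left by definition; the chamber argument has to split off the letter
  that acts first on a vector.\<close>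

lemma word_Suc_right:
  assumes "word (Suc n) g"
  shows "\<exists>w a. a \<in> simple \<and> word n w \<and> g = w ** reflection_matrix a"
  using assms
proof (induction n arbitrary: g)
  case 0
  then show ?case
    by (auto simp: word_Suc_iff)
next
  case (Suc n)
  then obtain b v where b: "b \<in> simple" "word (Suc n) v" "g = reflection_matrix b ** v"
    by (auto simp: word_Suc_iff[of "Suc n"])
  with Suc.IH obtain w a where "a \<in> simple" "word n w" "v = w ** reflection_matrix a"
    by blast
  then show ?case
    using b word_Suc by (metis matrix_mul_assoc)
qed

text \<open>The exchange condition: as the letters of \<open>w\<close> act on \<open>a\<close> one
  after the other, some letter first makes it non-positive. The root reached just before is that
  letter's own simple root, and multiplying by the reflection in \<open>a\<close> deletes this
  letter.\<close>

lemma word_exchange: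
  assumes "word n w" and a: "a \<in> simple" and neg: "w *v a \<notin> U"
  shows "\<exists>k<n. word k (w ** reflection_matrix a)"
  using assms(1) neg
proof induction
  case word_0
  then show ?case using simple_imp_positive[OF a] by simp
next
  case (word_Suc t n w)
  show ?case
  proof (cases "w *v a \<in> U")
    case False
    then obtain k where "k < n" "word k (w ** reflection_matrix a)"
      using word_Suc.IH by blast
    then have "word (Suc k) (reflection_matrix t ** w ** reflection_matrix a)" "Suc k < Suc n"
      using word.word_Suc[OF word_Suc.hyps(1)] by (auto simp flip: matrix_mul_assoc)
    then show ?thesis by blast
  next
    case True
    \<comment> \<open>The only positive root that a simple reflection can make non-positive is its
      own.\<close>
    then have "w *v a = t"
      using simple_reflection[OF word_Suc.hyps(1)] word_Suc.prems
      by (auto simp flip: matrix_vector_mul_assoc)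
    moreover have w: "orthogonal_matrix w"
      using word_Suc.hyps(2) word_mem orthogonal by blast
    ultimately have "reflection_matrix t = w ** reflection_matrix a ** transpose w"
      using reflection_matrix_orthogonal_image by blast
    then have "reflection_matrix t ** w ** reflection_matrix a
        = w ** reflection_matrix a ** (transpose w ** w) ** reflection_matrix a"
      by (simp add: matrix_mul_assoc)
    also have "\<dots> = w ** (reflection_matrix a ** reflection_matrix a)"
      using w by (simp add: orthogonal_matrix_def matrix_mul_assoc)
    also have "\<dots> = w"
      using simple_imp_positive[OF a] by (simp add: reflection_matrix_square norm_root)
    finally show ?thesis
      using word_Suc.hyps(2) by auto
  qed
qed

text \<open>Reflecting \<open>u\<close> in a simple root that has positive inner product with it
  lowers \<open>l\<close> and conjugates the reflection by a single letter. Counting the positive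
  roots below \<open>u\<close> makes this descent well-founded.\<close>

lemma word_reflection: "u \<in> U \<Longrightarrow> \<exists>n. word n (reflection_matrix u)"
proof (induction "card {v \<in> U. l v < l u}" arbitrary: u rule: less_induct)
  case less
  obtain a where a: "a \<in> simple" "u \<bullet> a > 0"
    using ex_simple_inner_pos[OF less.prems] by blast
  show ?case
  proof (cases "u = a")
    case True
    then show ?thesis using word_simple a by blast
  next
    case False
    define v where "v = reflection_matrix a *v u"
    have v: "v \<in> U"
      using simple_reflection a less.prems False by (simp add: v_def)
    have "l v < l u"
      using a l_pos[OF simple_imp_positive[OF a(1)]] by (simp add: v_def l_reflection inner_commute)
    then have "{w \<in> U. l w < l v} \<subset> {w \<in> U. l w < l u}"
      using v by auto
    then have "card {w \<in> U. l w < l v} < card {w \<in> U. l w < l u}"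
      using finite_U by (simp add: psubset_card_mono)
    then obtain n where n: "word n (reflection_matrix v)"
      using less.hyps v by blast
    have A: "reflection_matrix a \<in> G"
      using a by (simp add: reflection_mem simple_imp_positive)
    have "u = reflection_matrix a *v v"
      using inverse_vec(1)[OF A, of u] by (simp add: v_def)
    then have "reflection_matrix u = reflection_matrix a ** reflection_matrix v ** reflection_matrix a"
      using reflection_matrix_orthogonal_image[OF orthogonal[OF A]] by simp
    then show ?thesis
      using word_mult[OF word_mult[OF word_simple[OF a(1)] n] word_simple[OF a(1)]] by auto
  qed
qed

text \<open>Each generator is its own inverse and is the reflection in a positive root, after a
  change of sign if necessary.\<close>

lemma ex_word:
  assumes "g \<in> G"
  shows "\<exists>n. word n g"
proof -
  obtain R where R: "R \<subseteq> reflection_matrix ` {u. norm u = 1}" "G = generate orthogonal_group R"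
    using group by (auto simp: finite_reflection_group_def)
  have gen: "\<exists>n. word n h" "inv\<^bsub>orthogonal_group\<^esub> h = h" if h: "h \<in> R" for h
  proof -
    obtain u where u: "norm u = 1" "h = reflection_matrix u"
      using R h by auto
    have "h \<in> G"
      unfolding R(2) using h by (rule generate.incl)
    then show "inv\<^bsub>orthogonal_group\<^esub> h = h"
      using orthogonal_group_inv[OF orthogonal] u by simp
    have "u \<in> root_system G"
      using u \<open>h \<in> G\<close> by (simp add: root_system_def)
    then show "\<exists>n. word n h"
      using positive_or_negative word_reflection u by (metis reflection_matrix_uminus)
  qed
  have "g \<in> generate orthogonal_group R"
    using assms R by simp
  then show ?thesis
  proof induction
    case one
    show ?case by (rule exI[of _ 0]) (simp add: orthogonal_group_def)
  next
    case (incl h)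
    then show ?case by (rule gen(1))
  next
    case (inv h)
    then show ?case by (simp only: gen)
  next
    case (eng h1 h2)
    then obtain m n where "word m h1" "word n h2" by blast
    then have "word (m + n) (h1 ** h2)" by (rule word_mult)
    then show ?case by (auto simp: orthogonal_group_def)
  qed
qed

section \<open>The fundamental chamber\<close>

text \<open>Drop the last letter \<open>t\<close> of \<open>g\<close>. If \<open>w *v t\<close> is
  positive, this does not decrease the inner product; otherwise the exchange condition gives a
  shorter word for \<open>g\<close> itself.\<close>

lemma word_chamber_inner_le:
  assumes "word n g" and a: "a \<in> fundamental_chamber U" and b: "b \<in> fundamental_chamber U"
  shows "a \<bullet> (g *v b) \<le> a \<bullet> b"
  using assms(1)
proof (induction n arbitrary: g rule: less_induct)
  case (less n)
  show ?case
  proof (cases n)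
    case 0
    then show ?thesis
      using less.prems by simp
  next
    case (Suc m)
    then obtain w t where t: "t \<in> simple" and w: "word m w" and g: "g = w ** reflection_matrix t"
      using word_Suc_right less.prems by blast
    show ?thesis
    proof (cases "w *v t \<in> U")
      case True
      then have "0 \<le> a \<bullet> (w *v t)" "0 \<le> t \<bullet> b"
        using a b simple_imp_positive[OF t] by (auto simp: fundamental_chamber_def inner_commute)
      moreover have "a \<bullet> (g *v b) = a \<bullet> (w *v b) - 2 * (t \<bullet> b) * (a \<bullet> (w *v t))"
        by (simp add: g reflection_matrix_vector_mult matrix_vector_mult_diff_distrib
            matrix_vector_mult_scaleR inner_diff_right flip: matrix_vector_mul_assoc)
      ultimately have "a \<bullet> (g *v b) \<le> a \<bullet> (w *v b)"
        by simp
      then show ?thesis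
        using less.IH[OF _ w] Suc by force
    next
      case False
      then obtain k where "k < m" "word k g"
        using word_exchange[OF w t] g by blast
      then show ?thesis
        using less.IH[of k g] Suc by simp
    qed
  qed
qed

lemma chamber_inner_le:
  assumes "g \<in> G" "a \<in> fundamental_chamber U" "b \<in> fundamental_chamber U"
  shows "a \<bullet> (g *v b) \<le> a \<bullet> b"
proof -
  obtain n where "word n g"
    using ex_word[OF assms(1)] ..
  then show ?thesis
    using assms(2,3) by (rule word_chamber_inner_le)
qed

text \<open>Both points have the same norm, and \<open>chamber_inner_le\<close> bounds its square by
  their inner product, so their distance is zero.\<close>

lemma chamber_orbit_unique:
  assumes g: "g \<in> G" and a: "a \<in> fundamental_chamber U" and ga: "g *v a \<in> fundamental_chamber U"
  shows "g *v a = a"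
proof -
  have "a \<bullet> a \<le> (g *v a) \<bullet> a"
    using chamber_inner_le[OF g ga a] inner_image[OF g, of a a] by simp
  then have "(g *v a - a) \<bullet> (g *v a - a) \<le> 0"
    using inner_image[OF g, of a a] by (simp add: inner_diff_left inner_diff_right inner_commute)
  then show ?thesis by (metis eq_iff_diff_eq_0 inner_gt_zero_iff not_less)
qed

text \<open>Take the orbit point on which \<open>l\<close> is largest.\<close>

lemma ex_chamber_image: "\<exists>g \<in> G. g *v x \<in> fundamental_chamber U"
proof -
  have "G \<noteq> {}" using one_mem by auto
  obtain g where g: "g \<in> G" and max: "\<And>h. h \<in> G \<Longrightarrow> l (h *v x) \<le> l (g *v x)"
  proof -
    have "Max ((\<lambda>g. l (g *v x)) ` G) \<in> (\<lambda>g. l (g *v x)) ` G"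
      using finite_G \<open>G \<noteq> {}\<close> by (intro Max_in) auto
    then obtain g where "g \<in> G" "l (g *v x) = Max ((\<lambda>g. l (g *v x)) ` G)"
      by auto
    then show ?thesis
      using that finite_G by auto
  qed
  have "0 \<le> (g *v x) \<bullet> u" if u: "u \<in> U" for u
  proof -
    \<comment> \<open>The reflected point lies in the same orbit; were the inner product negative,
      its \<open>l\<close> would be larger.\<close>
    have "l (reflection_matrix u *v (g *v x)) \<le> l (g *v x)"
      using max[OF mult_mem[OF reflection_mem[OF u] g]] by (simp add: matrix_vector_mul_assoc)
    then show ?thesis
      using l_pos[OF u] by (simp add: l_reflection zero_le_mult_iff inner_commute)
  qed
  then show ?thesis
    using g by (auto simp: fundamental_chamber_def)
qed

lemma chamber_rep_obtain:
  obtains g where "g \<in> G" "chamber_rep G U x = g *v x" "g *v x \<in> fundamental_chamber U"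
proof -
  obtain g where g: "g \<in> G" "g *v x \<in> fundamental_chamber U"
    using ex_chamber_image by blast
  have "chamber_rep G U x = g *v x"
    unfolding chamber_rep_def
  proof (rule the_equality)
    show "g *v x \<in> matrix_orbit G x \<inter> fundamental_chamber U"
      using g by (auto simp: matrix_orbit_def)
  next
    fix z assume "z \<in> matrix_orbit G x \<inter> fundamental_chamber U"
    then obtain h where h: "h \<in> G" "z = h *v x" "z \<in> fundamental_chamber U"
      by (auto simp: matrix_orbit_def)
    have "z = (h ** transpose g) *v (g *v x)"
      using g by (simp add: h flip: matrix_vector_mul_assoc)
    then show "z = g *v x"
      using chamber_orbit_unique[OF mult_mem[OF h(1) transpose_mem[OF g(1)]] g(2)] h by simp
  qed
  then show ?thesis
    using that g by blast
qed

text \<open>Written in terms of the two representatives, the left-hand side is an inner product with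
  one of them moved by an element of \<open>G\<close>.\<close>

lemma inner_le_chamber_rep:
  assumes g: "g \<in> G"
  shows "(g *v x) \<bullet> y \<le> chamber_rep G U x \<bullet> chamber_rep G U y"
proof -
  obtain h where h: "h \<in> G" "chamber_rep G U x = h *v x" "h *v x \<in> fundamental_chamber U"
    by (rule chamber_rep_obtain)
  obtain k where k: "k \<in> G" "chamber_rep G U y = k *v y" "k *v y \<in> fundamental_chamber U"
    by (rule chamber_rep_obtain)
  have "(g *v x) \<bullet> y = (h *v x) \<bullet> ((h ** transpose g ** transpose k) *v (k *v y))"
    using inner_image[OF h(1), of x "transpose g *v y"] inner_image[OF g, of x "transpose g *v y"]
      g k by (simp flip: matrix_vector_mul_assoc)
  also have "\<dots> \<le> (h *v x) \<bullet> (k *v y)"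
    using g h k by (intro chamber_inner_le mult_mem transpose_mem)
  finally show ?thesis
    using h k by simp
qed

end

section \<open>Subgradients of an invariant function\<close>

lemma subdifferential_iff:
  "y \<in> subdifferential f x \<longleftrightarrow> (\<forall>z. y \<bullet> z - f z \<le> y \<bullet> x - f x)"
  by (auto simp: subdifferential_def inner_diff_right algebra_simps)

theorem theorem1:
  fixes G :: "(real^'n^'n) set" and U :: "(real^'n) set" and f :: "real^'n \<Rightarrow> real"
    and x y :: "real^'n"
  assumes "finite_reflection_group G"
    and "positive_root_system G U"
    and "convex_on UNIV f"
    and "invariant_under G f"
  shows "y \<in> subdifferential f x \<longleftrightarrow>
    chamber_rep G U y \<in> subdifferential f (chamber_rep G U x) \<and>
    chamber_rep G U x \<bullet> chamber_rep G U y = x \<bullet> y"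
proof -
  obtain l where "positive_roots G U l"
    using assms(1,2) by (auto simp: positive_root_system_def positive_roots_def)
  then interpret positive_roots G U l .
  have f_inv: "f (g *v z) = f z" if "g \<in> G" for g z
    using assms(4) that by (simp add: invariant_under_def)
  obtain h where h: "h \<in> G" "chamber_rep G U x = h *v x"
    by (rule chamber_rep_obtain)
  obtain k where k: "k \<in> G" "chamber_rep G U y = k *v y"
    by (rule chamber_rep_obtain)
  \<comment> \<open>The conjugate of \<open>f\<close> agrees at \<open>y\<close> and
    \<open>k *v y\<close>, by the substitution of \<open>k *v z\<close> for \<open>z\<close>.
    Stating this through upper bounds \<open>c\<close> avoids suprema that may be infinite.\<close>
  have sup: "(\<forall>z. (k *v y) \<bullet> z - f z \<le> c) \<longleftrightarrow> (\<forall>z. y \<bullet> z - f z \<le> c)" for c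
    by (metis k(1) f_inv inner_image inverse_vec(2))
  have "chamber_rep G U x \<bullet> chamber_rep G U y = x \<bullet> y" if y: "y \<in> subdifferential f x"
  proof (rule antisym)
    \<comment> \<open>This test point has the same value of \<open>f\<close> as \<open>x\<close>,
      and its inner product with \<open>y\<close> is that of the representatives.\<close>
    have "y \<bullet> (transpose k *v (h *v x)) \<le> y \<bullet> x"
      using y[unfolded subdifferential_iff, rule_format, of "transpose k *v (h *v x)"]
      by (simp add: f_inv h(1) k(1) transpose_mem)
    moreover have "y \<bullet> (transpose k *v (h *v x)) = (k *v y) \<bullet> (h *v x)"
      using inner_image[OF k(1), of y "transpose k *v (h *v x)"] k(1) by simp
    ultimately show "chamber_rep G U x \<bullet> chamber_rep G U y \<le> x \<bullet> y"
      by (simp add: h(2) k(2) inner_commute)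
    show "x \<bullet> y \<le> chamber_rep G U x \<bullet> chamber_rep G U y"
      using inner_le_chamber_rep[OF one_mem] by simp
  qed
  \<comment> \<open>With equal inner products both conditions bound the conjugate by the same
    \<open>c\<close>, so \<open>sup\<close> applies.\<close>
  moreover have "y \<in> subdifferential f x \<longleftrightarrow> chamber_rep G U y \<in> subdifferential f (chamber_rep G U x)"
    if "chamber_rep G U x \<bullet> chamber_rep G U y = x \<bullet> y"
    using that by (simp add: subdifferential_iff h k sup f_inv inner_commute[of x]
        inner_commute[of "h *v x"])
  ultimately show ?thesis by blast
qed

end
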